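(* Let $d = \dim\mathcal{S}$ and $1 \leq k < d$. Let $\mathcal{E}_k \subset \mathcal{S}$ be a maximal $\nabla$-autoparallel submanifold of dimension $k$. Suppose that for each $P \in \mathcal{S}$ the infimum $\inf_{Q \in \mathcal{E}_k} \mathbf{D}[Q:P]$ is attained. Then $$\mathcal{S} = \bigcup_{P_0 \in \mathcal{E}_k} \mathcal{M}_k(P_0),$$ where the union is disjoint and $\mathcal{M}_k(P_0)$ denotes the dual complement of $\mathcal{E}_k$ at $P_0$.
   Context: Setting. Let $\alpha > 0$, let $\Theta \subset \mathbb{R}^d$ be a nonempty open convex set, and let $\varphi : \Theta \to \mathbb{R}$ be a smooth $\alpha$-exponentially concave function, i.e. $\Phi = e^{\alpha\varphi}$ is concave; assume moreover that the Hessian $\mathsf{D}^2\Phi$ is strictly negative definite at every point of $\Theta$ and that $1 - \alpha\, \mathsf{D}\varphi(\theta)\cdot\theta > 0$ for all $\theta \in \Theta$. Here $\mathsf{D}$ is the Euclidean gradient and $\cdot$ the Euclidean dot product. The $L^{(\alpha)}$-divergence of $\varphi$ is $$\mathbf{L}_\varphi^{(\alpha)}[\theta:\theta'] = \frac{1}{\alpha}\log\bigl(1 + \alpha\, \mathsf{D}\varphi(\theta')\cdot(\theta-\theta')\bigr) - (\varphi(\theta)-\varphi(\theta')), \quad \theta,\theta' \in \Theta.$$ The manifold $\mathcal{S}$ is the $d$-dimensional manifold with global (primal) coordinate system $P \mapsto \theta_P \in \Theta$ (a bijection onto $\Theta$). The dual coordinate system is $$\eta_P = \mathsf{T}(\theta_P)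 := \frac{\mathsf{D}\varphi(\theta_P)}{1-\alpha\,\mathsf{D}\varphi(\theta_P)\cdot\theta_P},$$ where $\mathsf{T}$ is a diffeomorphism of $\Theta$ onto its (open) range $\Omega \subset \mathbb{R}^d$. Define the divergence on $\mathcal{S}$ by $\mathbf{D}[P:Q] := \mathbf{L}_\varphi^{(\alpha)}[\theta_P:\theta_Q]$. Riemannian metric. $\langle\cdot,\cdot\rangle = g$ is the Riemannian metric on $\mathcal{S}$ induced by $\mathbf{D}$ in the sense of Eguchi: in primal coordinates, $$g_{ij}(\theta) = \left\langle \frac{\partial}{\partial\theta_i},\frac{\partial}{\partial\theta_j}\right\rangle = -\left.\frac{\partial^2}{\partial\theta_i\,\partial\theta'_j}\mathbf{L}_\varphi^{(\alpha)}[\theta:\theta']\right|_{\theta'=\theta}.$$ Autoparallel submanifolds. A maximal $\nabla$-autoparallel submanifold of dimension $k$ is a nonempty set of the form $\{P \in \mathcal{S} : \theta_P - \theta_{P_0} \in A_0\}$, where $P_0 \in \mathcal{S}$ and $A_0 \subset \mathbb{R}^d$ is a $k$-dimensional vector subspace. A maximal $\nabla^*$-autoparallel submanifold of dimension $d-k$ is a nonempty set of the form $\{P \in \mathcal{S} : \eta_P - \eta_{P_0} \in B_0\}$, where $P_0 \in \mathcal{S}$ and $B_0 \subset \mathbb{R}^d$ is a $(d-k)$-dimensional vector subspace. Dual complement. For $P_0 \in \mathcal{E}_k$, the dual complement $\mathcal{M}_k(P_0)$ of $\mathcal{E}_k$ at $P_0$ is the unique maximal $\nabla^*$-autoparallel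 submanifold of dimension $d-k$ such that $\mathcal{E}_k \cap \mathcal{M}_k(P_0) = \{P_0\}$ and $\langle u,v\rangle = 0$ for all $u \in T_{P_0}\mathcal{E}_k$, $v \in T_{P_0}\mathcal{M}_k(P_0)$. (It exists and is unique. Explicitly, if $\mathcal{E}_k = \{P : \theta_P - \theta_{P_0} \in A_0\}$, then $\mathcal{M}_k(P_0) = \{P \in \mathcal{S} : \eta_P - \eta_{P_0} \in B_0\}$, where $B_0$ is the set of $b \in \mathbb{R}^d$ such that $\langle \sum_i a_i \frac{\partial}{\partial\theta_i}, \sum_j b_j\frac{\partial}{\partial\eta_j}\rangle = 0$ at $P_0$ for all $a \in A_0$.) *)

theory Defs
  imports "HOL-Analysis.Analysis"
begin

definition partial :: "'n \<Rightarrow> (real ^ 'n \<Rightarrow> real) \<Rightarrow> real ^ 'n \<Rightarrow> real" where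
  "partial i f x = deriv (\<lambda>t. f (x + t *\<^sub>R axis i 1)) 0"

definition gradient :: "(real ^ 'n \<Rightarrow> real) \<Rightarrow> real ^ 'n \<Rightarrow> real ^ 'n" where
  "gradient f x = (\<chi> i. partial i f x)"

definition hessian :: "(real ^ 'n \<Rightarrow> real) \<Rightarrow> real ^ 'n \<Rightarrow> real ^ 'n ^ 'n" where
  "hessian f x = (\<chi> i j. partial i (partial j f) x)"

(* Meant for open X: all iterated directional derivatives up to order n exist and are
   continuous on X. *)
primrec Ck_on :: "nat \<Rightarrow> (real ^ 'n \<Rightarrow> real) \<Rightarrow> (real ^ 'n) set \<Rightarrow> bool" where
  "Ck_on 0 f X \<longleftrightarrow> continuous_on X f"
| "Ck_on (Suc n) f X \<longleftrightarrow>
     (\<forall>x\<in>X. f differentiable (at x)) \<and> (\<forall>v. Ck_on n (\<lambda>x. frechet_derivative f (at x) v) X)"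

definition smooth_on :: "(real ^ 'n \<Rightarrow> real) \<Rightarrow> (real ^ 'n) set \<Rightarrow> bool" where
  "smooth_on f X \<longleftrightarrow> (\<forall>n. Ck_on n f X)"

definition L_div :: "real \<Rightarrow> (real ^ 'n \<Rightarrow> real) \<Rightarrow> real ^ 'n \<Rightarrow> real ^ 'n \<Rightarrow> real" where
  "L_div \<alpha> \<phi> x y = 1 / \<alpha> * ln (1 + \<alpha> * (gradient \<phi> y \<bullet> (x - y))) - (\<phi> x - \<phi> y)"

(* Coordinate change from primal to dual coordinates. *)
definition dual_map :: "real \<Rightarrow> (real ^ 'n \<Rightarrow> real) \<Rightarrow> real ^ 'n \<Rightarrow> real ^ 'n" where
  "dual_map \<alpha> \<phi> x = (1 / (1 - \<alpha> * (gradient \<phi> x \<bullet> x))) *\<^sub>R gradient \<phi> x"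

(* Points of the manifold form a set S :: 's set; "theta" is the global primal chart. *)
definition eta :: "real \<Rightarrow> (real ^ 'n \<Rightarrow> real) \<Rightarrow> ('s \<Rightarrow> real ^ 'n) \<Rightarrow> 's \<Rightarrow> real ^ 'n" where
  "eta \<alpha> \<phi> theta P = dual_map \<alpha> \<phi> (theta P)"

definition divergence ::
    "real \<Rightarrow> (real ^ 'n \<Rightarrow> real) \<Rightarrow> ('s \<Rightarrow> real ^ 'n) \<Rightarrow> 's \<Rightarrow> 's \<Rightarrow> real" where
  "divergence \<alpha> \<phi> theta P Q = L_div \<alpha> \<phi> (theta P) (theta Q)"

(* Eguchi's metric of a divergence L[x:y]: differentiate once in each argument, then restrict
   to the diagonal. *)
definition eguchi_metric :: "(real ^ 'n \<Rightarrow> real ^ 'n \<Rightarrow> real) \<Rightarrow> real ^ 'n \<Rightarrow> real ^ 'n ^ 'n" where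
  "eguchi_metric L z = (\<chi> i j. - partial i (\<lambda>x. partial j (\<lambda>y. L x y) z) z)"

(* A tangent vector is represented by its components with respect to the primal frame
   (the coordinate vector fields of theta). *)
definition riemannian_inner ::
    "real \<Rightarrow> (real ^ 'n \<Rightarrow> real) \<Rightarrow> ('s \<Rightarrow> real ^ 'n) \<Rightarrow> 's \<Rightarrow> real ^ 'n \<Rightarrow> real ^ 'n \<Rightarrow> real" where
  "riemannian_inner \<alpha> \<phi> theta P u v =
     (\<Sum>i\<in>UNIV. \<Sum>j\<in>UNIV. eguchi_metric (L_div \<alpha> \<phi>) (theta P) $ i $ j * u $ i * v $ j)"

(* Velocities at P, in primal components, of curves in M through P. *)
definition tangent_space :: "('s \<Rightarrow> real ^ 'n) \<Rightarrow> 's set \<Rightarrow> 's \<Rightarrow> (real ^ 'n) set" where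
  "tangent_space theta M P =
     {u. \<exists>c :: real \<Rightarrow> 's. c 0 = P \<and> (\<forall>\<^sub>F t in nhds 0. c t \<in> M) \<and>
           ((\<lambda>t. theta (c t)) has_vector_derivative u) (at 0)}"

(* Maximal submanifold of dimension k that is affine in the global coordinates "crd":
   crd = theta gives the nabla-autoparallel ones, crd = eta the dual ones.
   Nonempty because it contains P0. *)
definition maximal_autoparallel :: "'s set \<Rightarrow> ('s \<Rightarrow> real ^ 'n) \<Rightarrow> nat \<Rightarrow> 's set \<Rightarrow> bool" where
  "maximal_autoparallel S crd k M \<longleftrightarrow>
     (\<exists>P0\<in>S. \<exists>A. subspace A \<and> dim A = k \<and> M = {P \<in> S. crd P - crd P0 \<in> A})"

definition dual_complement ::
    "'s set \<Rightarrow> real \<Rightarrow> (real ^ 'n \<Rightarrow> real) \<Rightarrow> ('s \<Rightarrow> real ^ 'n) \<Rightarrow> nat \<Rightarrow> 's set \<Rightarrow> 's \<Rightarrow> 's set" where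
  "dual_complement S \<alpha> \<phi> theta k E P0 =
     (THE M. maximal_autoparallel S (eta \<alpha> \<phi> theta) (CARD('n) - k) M \<and> E \<inter> M = {P0} \<and>
        (\<forall>u \<in> tangent_space theta E P0. \<forall>v \<in> tangent_space theta M P0.
           riemannian_inner \<alpha> \<phi> theta P0 u v = 0))"

end

theory Submission
  imports Defs
begin

text \<open>
  Write \<open>p\<close> for the gradient of \<open>\<phi>\<close>. For a subspace \<open>A\<close> and a point \<open>x\<close>, each of the following
  conditions on \<open>y\<close> says that \<open>\<eta>(y) - \<eta>(x)\<close> lies in one explicit linear subspace \<open>B(x)\<close>, of
  dimension \<open>d - dim A\<close>: (i) \<open>x\<close> is critical for \<open>L[\<cdot> : y]\<close> along \<open>x + A\<close>; (ii) the Pythagorean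
  relation \<open>L[q : y] = L[q : x] + L[x : y]\<close> holds for all \<open>q\<close> in \<open>x + A\<close>. Moreover \<open>B(x)\<close> is the
  image under the derivative of \<open>\<eta>\<close> of the \<open>g\<close>-orthogonal complement of \<open>A\<close>, so it is the
  direction of the dual complement. Minimizers therefore give the covering by (i). If \<open>y\<close> lies in
  the dual complements at \<open>x\<close> and at \<open>q\<close>, adding the two relations (ii) gives
  \<open>L[q : x] + L[x : q] = 0\<close>, hence \<open>x = q\<close>, because \<open>L\<close> is positive off the diagonal.
\<close>

section \<open>Calculus: partial derivatives, the gradient and expansion in coordinates\<close>

lemma has_vector_derivative_along_line:
  assumes "(f has_derivative f') (at (y + t *\<^sub>R v))"
  shows "((\<lambda>s. f (y + s *\<^sub>R v)) has_vector_derivative f' v) (at t)"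
proof -
  have "((\<lambda>s. y + s *\<^sub>R v) has_vector_derivative v) (at t)"
    by (auto intro!: derivative_eq_intros)
  from vector_derivative_diff_chain_within[OF this, of f f'] assms
  show ?thesis by (simp add: o_def has_derivative_at_withinI)
qed

lemma partial_eq:
  assumes "(f has_derivative f') (at x)"
  shows "partial i f x = f' (axis i 1)"
proof -
  have "((\<lambda>s. f (x + s *\<^sub>R axis i 1)) has_vector_derivative f' (axis i 1)) (at 0)"
    using has_vector_derivative_along_line[of f f' x 0 "axis i 1"] assms by simp
  then show ?thesis
    unfolding partial_def
    by (intro DERIV_imp_deriv) (simp add: has_real_derivative_iff_has_vector_derivative)
qed

lemma linear_axis_expansion:
  fixes f :: "real ^ 'n \<Rightarrow> 'b::real_vector"
  assumes "linear f"
  shows "f v = (\<Sum>i\<in>UNIV. v $ i *\<^sub>R f (axis i 1))"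
proof -
  have "f v = f (\<Sum>i\<in>UNIV. v $ i *\<^sub>R axis i 1)"
    using basis_expansion[of v] by (simp add: scalar_mult_eq_scaleR)
  then show ?thesis using assms by (simp add: linear_sum linear_scale)
qed

lemma gradient_inner:
  assumes "(f has_derivative f') (at x)"
  shows "f' = (\<lambda>v. gradient f x \<bullet> v)"
proof
  fix v
  have lin: "linear f'" using assms has_derivative_linear by blast
  have "f' v = (\<Sum>i\<in>UNIV. v $ i * f' (axis i 1))"
    by (rule linear_axis_expansion[OF lin, unfolded real_scaleR_def])
  also have "\<dots> = gradient f x \<bullet> v"
    by (simp add: gradient_def inner_vec_def partial_eq[OF assms] mult.commute)
  finally show "f' v = gradient f x \<bullet> v" .
qed

text \<open>On \<open>X\<close> each partial derivative is the Frechet derivative applied to an axis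
  vector, and \<open>Ck_on 2\<close> makes that function differentiable. Openness of
  \<open>X\<close> transfers this to the components of the gradient.\<close>

lemma gradient_differentiable_of_Ck:
  fixes f :: "real ^ 'n \<Rightarrow> real"
  assumes "Ck_on 2 f X" "open X" "x \<in> X"
  shows "gradient f differentiable (at x)"
proof -
  have diff: "\<And>z. z \<in> X \<Longrightarrow> f differentiable (at z)"
    and diff2: "\<And>z v. z \<in> X \<Longrightarrow> (\<lambda>x. frechet_derivative f (at x) v) differentiable (at z)"
    using assms(1) by (auto simp: numeral_2_eq_2)
  have eq: "partial i f z = frechet_derivative f (at z) (axis i 1)" if "z \<in> X" for i z
    using diff[OF that] by (intro partial_eq) (simp flip: frechet_derivative_works)
  have comp: "(\<lambda>z. gradient f z \<bullet> axis i 1) differentiable (at x)" for i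
  proof -
    obtain D where "((\<lambda>x. frechet_derivative f (at x) (axis i 1)) has_derivative D) (at x)"
      using diff2[OF \<open>x \<in> X\<close>] unfolding differentiable_def by blast
    then have "((\<lambda>z. gradient f z \<bullet> axis i 1) has_derivative D) (at x)"
      by (rule has_derivative_transform_within_open[OF _ \<open>open X\<close> \<open>x \<in> X\<close>])
         (simp add: gradient_def eq inner_axis)
    then show ?thesis unfolding differentiable_def by blast
  qed
  show ?thesis
    using comp by (subst differentiable_componentwise_within) (auto simp: Basis_vec_def)
qed

section \<open>Affine slices in a global chart\<close>

lemma affine_slice_rebase:
  assumes A: "subspace A" and P0: "P0 \<in> S" "crd P0 - crd P1 \<in> A"
  shows "{P \<in> S. crd P - crd P1 \<in> A} = {P \<in> S. crd P - crd P0 \<in> A}"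
proof -
  have "crd P - crd P1 \<in> A \<longleftrightarrow> crd P - crd P0 \<in> A" for P
    using subspace_diff[OF A _ P0(2), of "crd P - crd P1"]
      subspace_add[OF A _ P0(2), of "crd P - crd P0"] by auto
  then show ?thesis by simp
qed

text \<open>Any point of the submanifold may serve as base point. Dual complements are anchored at a
  prescribed point, while the definition only supplies some base point.\<close>

lemma autoparallel_rebase:
  assumes "maximal_autoparallel S crd k M" "P0 \<in> M"
  obtains A where "subspace A" "dim A = k" "M = {P \<in> S. crd P - crd P0 \<in> A}"
proof -
  obtain P1 A where A: "subspace A" "dim A = k" and M: "M = {P \<in> S. crd P - crd P1 \<in> A}"
    using assms(1) unfolding maximal_autoparallel_def by blast
  have P0: "P0 \<in> S" "crd P0 - crd P1 \<in> A" using assms(2) unfolding M by simp_all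
  show ?thesis by (rule that[OF A]) (unfold M, rule affine_slice_rebase[OF A(1) P0])
qed

text \<open>The difference quotients lie in \<open>B\<close>, and a subspace of a finite-dimensional
  space is closed, so it contains their limit.\<close>

lemma derivative_mem_subspace:
  fixes B :: "(real ^ 'd) set"
  assumes "subspace B" "(f has_vector_derivative v) (at 0)"
    and "\<forall>\<^sub>F t in nhds (0::real). f t - f 0 \<in> B"
  shows "v \<in> B"
proof -
  have "((\<lambda>t. norm (f t - f 0 - t *\<^sub>R v) / norm t) \<longlongrightarrow> 0) (at 0)"
    using assms(2) by (simp add: has_vector_derivative_def has_derivative_at)
  moreover have "\<forall>\<^sub>F t in at 0.
      norm (f t - f 0 - t *\<^sub>R v) / norm t = norm ((1 / t) *\<^sub>R (f t - f 0) - v)"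
    unfolding eventually_at_filter
  proof (intro always_eventually allI impI)
    fix t :: real assume "t \<noteq> 0"
    then have "(1 / t) *\<^sub>R (f t - f 0) - v = (1 / t) *\<^sub>R (f t - f 0 - t *\<^sub>R v)"
      by (simp add: scaleR_diff_right)
    then show "norm (f t - f 0 - t *\<^sub>R v) / norm t = norm ((1 / t) *\<^sub>R (f t - f 0) - v)"
      by simp
  qed
  ultimately have "((\<lambda>t. norm ((1 / t) *\<^sub>R (f t - f 0) - v)) \<longlongrightarrow> 0) (at 0)"
    by (rule Lim_transform_eventually)
  then have "((\<lambda>t. (1 / t) *\<^sub>R (f t - f 0)) \<longlongrightarrow> v) (at 0)"
    by (rule LIM_zero_cancel[OF tendsto_norm_zero_cancel])
  moreover have "\<forall>\<^sub>F t in at 0. (1 / t) *\<^sub>R (f t - f 0) \<in> B"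
    using assms(3) unfolding eventually_at_filter
    by (rule eventually_mono) (auto intro: subspace_scale[OF assms(1)])
  ultimately show ?thesis
    by (intro Lim_in_closed_set[OF closed_subspace[OF assms(1)] _ at_neq_bot])
qed

section \<open>The potential and the Hessian of its exponential\<close>

text \<open>\<open>H x\<close> is the second derivative of \<phi> as a linear map.
  \<open>hessian_negative\<close> is the strict negativity of the Hessian of
  \<open>exp (\<alpha> * \<phi> x)\<close> after division by the positive factor
  \<open>\<alpha> * exp (\<alpha> * \<phi> x)\<close>.\<close>

locale exp_concave_potential =
  fixes \<alpha> :: real
    and \<Theta> :: "(real ^ 'd) set"
    and \<phi> :: "real ^ 'd \<Rightarrow> real"
    and H :: "real ^ 'd \<Rightarrow> real ^ 'd \<Rightarrow> real ^ 'd"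
  assumes alpha_pos: "\<alpha> > 0"
    and open_domain: "open \<Theta>"
    and convex_domain: "convex \<Theta>"
    and has_derivative_potential:
      "x \<in> \<Theta> \<Longrightarrow> (\<phi> has_derivative (\<lambda>v. gradient \<phi> x \<bullet> v)) (at x)"
    and has_derivative_gradient: "x \<in> \<Theta> \<Longrightarrow> (gradient \<phi> has_derivative H x) (at x)"
    and hessian_negative:
      "x \<in> \<Theta> \<Longrightarrow> v \<noteq> 0 \<Longrightarrow> v \<bullet> H x v + \<alpha> * (gradient \<phi> x \<bullet> v)\<^sup>2 < 0"
    and weight_pos: "x \<in> \<Theta> \<Longrightarrow> 1 - \<alpha> * (gradient \<phi> x \<bullet> x) > 0"

text \<open>Chain and product rule, applied twice. This links the matrix hypothesis of the theorem
  to the form \<open>hessian_negative\<close> used in the locale.\<close>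

lemma hessian_exp_quadratic_form:
  fixes \<phi> :: "real ^ 'd \<Rightarrow> real"
  assumes "open \<Theta>" "x \<in> \<Theta>"
    and phi: "\<And>x. x \<in> \<Theta> \<Longrightarrow> (\<phi> has_derivative (\<lambda>v. gradient \<phi> x \<bullet> v)) (at x)"
    and grad: "(gradient \<phi> has_derivative H) (at x)"
  shows "v \<bullet> (hessian (\<lambda>y. exp (\<alpha> * \<phi> y)) x *v v) =
    \<alpha> * exp (\<alpha> * \<phi> x) * (v \<bullet> H v + \<alpha> * (gradient \<phi> x \<bullet> v)\<^sup>2)"
proof -
  let ?F = "\<lambda>y. exp (\<alpha> * \<phi> y)" and ?p = "gradient \<phi> x"
  have lin: "linear H" using grad has_derivative_linear by blast
  have F': "(?F has_derivative (\<lambda>v. \<alpha> * ?F z * (gradient \<phi> z \<bullet> v))) (at z)" if "z \<in> \<Theta>" for z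
    by (rule derivative_eq_intros phi[OF that] refl)+ (simp add: ac_simps)
  have 1: "partial j ?F z = \<alpha> * ?F z * (gradient \<phi> z $ j)" if "z \<in> \<Theta>" for j z
    by (subst partial_eq[OF F'[OF that]]) (simp add: inner_axis)
  have 2: "partial i (partial j ?F) x = \<alpha> * ?F x * (H (axis i 1) $ j + \<alpha> * ?p $ i * ?p $ j)" for i j
  proof -
    have "((\<lambda>z. \<alpha> * ?F z * (gradient \<phi> z $ j)) has_derivative
        (\<lambda>v. \<alpha> * ?F x * (H v $ j + \<alpha> * (?p \<bullet> v) * ?p $ j))) (at x)"
      by (rule derivative_eq_intros F'[OF assms(2)] grad
          bounded_linear.has_derivative[OF bounded_linear_vec_nth] refl)+
         (simp add: algebra_simps)
    then have "(partial j ?F has_derivative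
        (\<lambda>v. \<alpha> * ?F x * (H v $ j + \<alpha> * (?p \<bullet> v) * ?p $ j))) (at x)"
      by (rule has_derivative_transform_within_open[OF _ assms(1,2)]) (simp add: 1)
    from partial_eq[OF this] show ?thesis by (simp add: inner_axis)
  qed
  have "v \<bullet> (hessian ?F x *v v) = (\<Sum>i\<in>UNIV. \<Sum>j\<in>UNIV. v $ i * hessian ?F x $ i $ j * v $ j)"
    by (simp add: inner_vec_def matrix_vector_mult_def sum_distrib_left ac_simps)
  also have "\<dots> = (\<Sum>i\<in>UNIV. \<Sum>j\<in>UNIV. \<alpha> * ?F x *
      (v $ i * H (axis i 1) $ j * v $ j + \<alpha> * (?p $ i * v $ i) * (?p $ j * v $ j)))"
    by (simp add: hessian_def 2 algebra_simps)
  also have "\<dots> = \<alpha> * ?F x * ((\<Sum>i\<in>UNIV. \<Sum>j\<in>UNIV. v $ i * H (axis i 1) $ j * v $ j)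
      + \<alpha> * (?p \<bullet> v)\<^sup>2)"
    by (simp add: inner_vec_def power2_eq_square sum_product sum.distrib sum_distrib_left
        distrib_left ac_simps)
  also have "(\<Sum>i\<in>UNIV. \<Sum>j\<in>UNIV. v $ i * H (axis i 1) $ j * v $ j) = v \<bullet> H v"
  proof -
    have "H v = (\<Sum>i\<in>UNIV. v $ i *\<^sub>R H (axis i 1))"
      by (rule linear_axis_expansion[OF lin])
    then show ?thesis
      by (subst sum.swap) (simp add: inner_vec_def sum_distrib_left ac_simps)
  qed
  finally show ?thesis .
qed

context exp_concave_potential
begin

abbreviation "p \<equiv> gradient \<phi>"
abbreviation "w x \<equiv> 1 - \<alpha> * (p x \<bullet> x)"

lemma linear_H: "x \<in> \<Theta> \<Longrightarrow> linear (H x)"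
  using has_derivative_gradient has_derivative_linear by blast

section \<open>Positivity of the divergence\<close>

text \<open>This is the strict tangent inequality at \<open>y\<close> for the exponential,
  normalized to 1 at \<open>y\<close>. On the segment from \<open>y\<close> to \<open>x\<close>, the
  mean value theorem gives \<open>f 1 - f 0\<close> as \<open>f' s\<close>, and a second use shows
  \<open>f' s < f' 0\<close>, since \<open>f''\<close> is negative.\<close>

lemma exp_strictly_concave:
  assumes "x \<in> \<Theta>" "y \<in> \<Theta>" "x \<noteq> y"
  shows "exp (\<alpha> * (\<phi> x - \<phi> y)) < 1 + \<alpha> * (p y \<bullet> (x - y))"
proof -
  define v where "v = x - y"
  define f where "f t = exp (\<alpha> * (\<phi> (y + t *\<^sub>R v) - \<phi> y))" for t
  define f' where "f' t = \<alpha> * (p (y + t *\<^sub>R v) \<bullet> v) * f t" for t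
  define f'' where
    "f'' t = \<alpha> * f t * (v \<bullet> H (y + t *\<^sub>R v) v + \<alpha> * (p (y + t *\<^sub>R v) \<bullet> v)\<^sup>2)" for t
  have mem: "y + t *\<^sub>R v \<in> \<Theta>" if "0 \<le> t" "t \<le> 1" for t
  proof -
    have "(1 - t) *\<^sub>R y + t *\<^sub>R x \<in> \<Theta>"
      using convex_domain assms that by (intro convexD_alt) auto
    then show ?thesis by (simp add: v_def algebra_simps)
  qed
  have f: "(f has_real_derivative f' t) (at t)" if "0 \<le> t" "t \<le> 1" for t
  proof -
    have "((\<lambda>t. \<phi> (y + t *\<^sub>R v)) has_real_derivative p (y + t *\<^sub>R v) \<bullet> v) (at t)"
      using has_vector_derivative_along_line[OF has_derivative_potential[OF mem[OF that]]]
      by (simp add: has_real_derivative_iff_has_vector_derivative)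
    then show ?thesis unfolding f_def[abs_def] f'_def
      by (auto intro!: derivative_eq_intros)
  qed
  have f': "(f' has_real_derivative f'' t) (at t)" if "0 \<le> t" "t \<le> 1" for t
  proof -
    have "((\<lambda>t. p (y + t *\<^sub>R v) \<bullet> v) has_real_derivative H (y + t *\<^sub>R v) v \<bullet> v) (at t)"
      using has_vector_derivative_along_line[OF has_derivative_gradient[OF mem[OF that]]]
        bounded_linear.has_vector_derivative[OF bounded_linear_inner_left]
      unfolding has_real_derivative_iff_has_vector_derivative by blast
    then show ?thesis unfolding f'_def[abs_def] f''_def
      by (auto intro!: derivative_eq_intros f[OF that] simp: f'_def inner_commute
          power2_eq_square algebra_simps)
  qed
  have neg: "f'' t < 0" if "0 \<le> t" "t \<le> 1" for t
    using hessian_negative[OF mem[OF that], of v] alpha_pos assms(3)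
    by (simp add: f''_def f_def v_def mult_less_0_iff)
  obtain s where s: "0 < s" "s < 1" "f 1 - f 0 = (1 - 0) * f' s"
    using MVT2[of 0 1 f f'] f by auto
  obtain r where r: "0 < r" "r < s" "f' s - f' 0 = (s - 0) * f'' r"
    using MVT2[of 0 s f' f''] f' s by auto
  have "s * f'' r < 0" using neg[of r] r s by (simp add: mult_less_0_iff)
  with r s have "f 1 < f 0 + f' 0" by simp
  then show ?thesis by (simp add: f_def f'_def v_def)
qed

text \<open>For distinct points this quantity lies above an exponential. Hence the logarithm in
  \<open>L_div\<close> is only taken of positive numbers.\<close>

lemma affine_factor_pos:
  assumes "x \<in> \<Theta>" "y \<in> \<Theta>"
  shows "1 + \<alpha> * (p y \<bullet> (x - y)) > 0"
proof (cases "x = y")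
  case False
  then show ?thesis by (rule less_trans[OF exp_gt_zero exp_strictly_concave[OF assms]])
qed simp

lemma L_div_pos:
  assumes "x \<in> \<Theta>" "y \<in> \<Theta>" "x \<noteq> y"
  shows "L_div \<alpha> \<phi> x y > 0"
proof -
  have "\<alpha> * (\<phi> x - \<phi> y) < ln (1 + \<alpha> * (p y \<bullet> (x - y)))"
    using exp_strictly_concave[OF assms] affine_factor_pos[OF assms(1,2)]
    by (metis exp_less_cancel_iff exp_ln)
  then show ?thesis using alpha_pos by (simp add: L_div_def field_simps)
qed

text \<open>
  \<open>conormal x\<close> is, up to a positive factor, the derivative at \<open>\<eta>(x)\<close> of
  \<open>\<eta> \<mapsto> \<eta> / (1 + \<alpha> (\<eta> \<bullet> x))\<close>, the gradient of \<open>L[\<cdot> : y]\<close> at \<open>x\<close> being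
  \<open>\<eta>(y) / (1 + \<alpha> (\<eta>(y) \<bullet> x)) - p x\<close>.
\<close>
definition conormal :: "real ^ 'd \<Rightarrow> real ^ 'd \<Rightarrow> real ^ 'd" where
  "conormal x b = b - (\<alpha> * (b \<bullet> x)) *\<^sub>R p x"

section \<open>The conormal map and the direction of the dual complement\<close>

lemma linear_conormal: "linear (conormal x)"
  by (rule linearI) (simp_all add: conormal_def algebra_simps)

lemma inj_conormal:
  assumes "x \<in> \<Theta>"
  shows "inj (conormal x)"
proof (subst linear_injective_0[OF linear_conormal], intro allI impI)
  fix b assume "conormal x b = 0"
  then have b: "b = (\<alpha> * (b \<bullet> x)) *\<^sub>R p x" by (simp add: conormal_def)
  \<comment> \<open>Pairing with \<open>x\<close> turns the vector equation into a scalar one, which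
    \<open>w x > 0\<close> solves.\<close>
  then have "b \<bullet> x = \<alpha> * (b \<bullet> x) * (p x \<bullet> x)" by (metis inner_scaleR_left)
  then have "(b \<bullet> x) * w x = 0" by (simp add: algebra_simps)
  then have "b \<bullet> x = 0" using weight_pos[OF assms] by auto
  with b show "b = 0" by simp
qed

text \<open>The subspace \<open>B(x)\<close> of the overview, written as the preimage under
  \<open>conormal x\<close> of the Euclidean orthogonal complement of \<open>A\<close>.\<close>

definition dual_complement_direction :: "(real ^ 'd) set \<Rightarrow> real ^ 'd \<Rightarrow> (real ^ 'd) set" where
  "dual_complement_direction A x = {b. \<forall>a\<in>A. a \<bullet> conormal x b = 0}"

lemma subspace_dual_complement_direction: "subspace (dual_complement_direction A x)"
  by (auto simp: subspace_def dual_complement_direction_def conormal_def algebra_simps)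

text \<open>The isomorphism \<open>conormal x\<close> carries this subspace onto the orthogonal
  complement of \<open>A\<close>.\<close>

lemma dim_dual_complement_direction:
  assumes "x \<in> \<Theta>" "subspace A"
  shows "dim (dual_complement_direction A x) = CARD('d) - dim A"
proof -
  have surj: "surj (conormal x)"
    using linear_injective_imp_surjective[OF linear_conormal inj_conormal[OF assms(1)]] by simp
  have "conormal x ` dual_complement_direction A x = {y \<in> UNIV. \<forall>a\<in>A. orthogonal a y}"
    unfolding dual_complement_direction_def orthogonal_def using surj by (auto simp: surj_def)
  moreover have "dim (conormal x ` dual_complement_direction A x)
      = dim (dual_complement_direction A x)"
    by (intro dim_image_eq linear_conormal inj_on_subset[OF inj_conormal[OF assms(1)]]) auto
  ultimately show ?thesis
    using dim_subspace_orthogonal_to_vectors[OF assms(2), of UNIV] by simp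
qed

text \<open>\<open>conormal x\<close> sends \<open>dual_map \<alpha> \<phi> x\<close> to
  \<open>p x\<close>, and the factor \<open>w y\<close> clears the denominator of
  \<open>dual_map \<alpha> \<phi> y\<close>. A linear condition in dual coordinates thereby becomes
  a relation between the two gradients.\<close>

lemma conormal_dual_map_diff:
  assumes "x \<in> \<Theta>" "y \<in> \<Theta>"
  shows "w y *\<^sub>R conormal x (dual_map \<alpha> \<phi> y - dual_map \<alpha> \<phi> x) =
    p y - (1 + \<alpha> * (p y \<bullet> (x - y))) *\<^sub>R p x"
proof -
  have wx: "w x \<noteq> 0" and wy: "w y \<noteq> 0" using weight_pos assms by force+
  have y: "w y *\<^sub>R conormal x (dual_map \<alpha> \<phi> y) = p y - (\<alpha> * (p y \<bullet> x)) *\<^sub>R p x"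
    using wy by (simp add: conormal_def dual_map_def scaleR_diff_right)
  have "w x *\<^sub>R conormal x (dual_map \<alpha> \<phi> x) = w x *\<^sub>R p x"
    using wx by (simp add: conormal_def dual_map_def scaleR_diff_right scaleR_diff_left)
  then have x: "conormal x (dual_map \<alpha> \<phi> x) = p x" using wx by simp
  show ?thesis
    unfolding linear_diff[OF linear_conormal] scaleR_diff_right y x
    by (simp add: algebra_simps)
qed

text \<open>The right side is the first-order condition for \<open>L_div \<alpha> \<phi> q y\<close>
  in \<open>q\<close> along \<open>x + A\<close> at \<open>q = x\<close>, with the denominator
  cleared.\<close>

lemma mem_dual_complement_direction_iff:
  assumes "x \<in> \<Theta>" "y \<in> \<Theta>"
  shows "dual_map \<alpha> \<phi> y - dual_map \<alpha> \<phi> x \<in> dual_complement_direction A x \<longleftrightarrow>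
    (\<forall>a\<in>A. p y \<bullet> a = (1 + \<alpha> * (p y \<bullet> (x - y))) * (p x \<bullet> a))"
proof -
  have "a \<bullet> conormal x (dual_map \<alpha> \<phi> y - dual_map \<alpha> \<phi> x) = 0 \<longleftrightarrow>
      a \<bullet> (w y *\<^sub>R conormal x (dual_map \<alpha> \<phi> y - dual_map \<alpha> \<phi> x)) = 0" for a
    using weight_pos[OF assms(2)] by simp
  then show ?thesis
    unfolding conormal_dual_map_diff[OF assms]
    by (simp add: dual_complement_direction_def inner_diff_right inner_commute)
qed

section \<open>The Pythagorean relation, uniqueness and minimizers\<close>

text \<open>Membership, tested on \<open>q - x\<close>, makes the argument of the logarithm for
  \<open>(q, y)\<close> the product of those for \<open>(q, x)\<close> and \<open>(x, y)\<close>.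
  The logarithm turns the product into a sum, and the differences of \<phi> telescope.\<close>

lemma generalized_pythagoras:
  assumes "x \<in> \<Theta>" "y \<in> \<Theta>" "q \<in> \<Theta>" "q - x \<in> A"
    and "dual_map \<alpha> \<phi> y - dual_map \<alpha> \<phi> x \<in> dual_complement_direction A x"
  shows "L_div \<alpha> \<phi> q y = L_div \<alpha> \<phi> q x + L_div \<alpha> \<phi> x y"
proof -
  have "p y \<bullet> (q - x) = (1 + \<alpha> * (p y \<bullet> (x - y))) * (p x \<bullet> (q - x))"
    using assms mem_dual_complement_direction_iff by blast
  moreover have "p y \<bullet> (q - y) = p y \<bullet> (x - y) + p y \<bullet> (q - x)"
    by (simp add: inner_diff_right)
  ultimately have "1 + \<alpha> * (p y \<bullet> (q - y)) =
      1 + \<alpha> * (p y \<bullet> (x - y)) + \<alpha> * ((1 + \<alpha> * (p y \<bullet> (x - y))) * (p x \<bullet> (q - x)))"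
    by (simp only: distrib_left add.assoc)
  also have "\<dots> = (1 + \<alpha> * (p y \<bullet> (x - y))) * (1 + \<alpha> * (p x \<bullet> (q - x)))"
    by (simp add: algebra_simps)
  finally have "ln (1 + \<alpha> * (p y \<bullet> (q - y))) =
      ln (1 + \<alpha> * (p y \<bullet> (x - y))) + ln (1 + \<alpha> * (p x \<bullet> (q - x)))"
    using ln_mult_pos[OF affine_factor_pos[OF assms(1,2)] affine_factor_pos[OF assms(3,1)]]
    by simp
  then show ?thesis by (simp add: L_div_def algebra_simps)
qed

lemma eq_if_common_dual_complement:
  assumes "x \<in> \<Theta>" "y \<in> \<Theta>" "q \<in> \<Theta>" "q - x \<in> A" "subspace A"
    and "dual_map \<alpha> \<phi> y - dual_map \<alpha> \<phi> x \<in> dual_complement_direction A x"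
    and "dual_map \<alpha> \<phi> y - dual_map \<alpha> \<phi> q \<in> dual_complement_direction A q"
  shows "x = q"
proof (rule ccontr)
  assume "x \<noteq> q"
  have "x - q \<in> A" using subspace_neg[OF assms(5,4)] by simp
  \<comment> \<open>The relation based at \<open>x\<close> is applied to \<open>q\<close>, the one
    based at \<open>q\<close> to \<open>x\<close>; the divergences from \<open>y\<close> cancel in
    the sum.\<close>
  then have "L_div \<alpha> \<phi> q x + L_div \<alpha> \<phi> x q = 0"
    using generalized_pythagoras[of x y q A] generalized_pythagoras[of q y x A] assms by simp
  then show False using L_div_pos[of q x] L_div_pos[of x q] assms \<open>x \<noteq> q\<close> by simp
qed

lemma inj_dual_map: "inj_on (dual_map \<alpha> \<phi>) \<Theta>"
proof (rule inj_onI)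
  fix x q assume xq: "x \<in> \<Theta>" "q \<in> \<Theta>" "dual_map \<alpha> \<phi> x = dual_map \<alpha> \<phi> q"
  then show "x = q"
    \<comment> \<open>With \<open>A = UNIV\<close> and \<open>y = x\<close>, both differences of
      dual coordinates vanish and so lie in any subspace.\<close>
    by (intro eq_if_common_dual_complement[of x x q UNIV])
       (auto intro: subspace_0[OF subspace_dual_complement_direction])
qed

lemma minimizer_imp_dual_complement:
  assumes x: "x \<in> \<Theta>" and y: "y \<in> \<Theta>" and A: "subspace A"
    and min: "\<And>q. q \<in> \<Theta> \<Longrightarrow> q - x \<in> A \<Longrightarrow> L_div \<alpha> \<phi> x y \<le> L_div \<alpha> \<phi> q y"
  shows "dual_map \<alpha> \<phi> y - dual_map \<alpha> \<phi> x \<in> dual_complement_direction A x"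
proof -
  have "p y \<bullet> a = (1 + \<alpha> * (p y \<bullet> (x - y))) * (p x \<bullet> a)" if "a \<in> A" for a
  proof -
    define f where "f t = L_div \<alpha> \<phi> (x + t *\<^sub>R a) y" for t
    define c where "c = 1 + \<alpha> * (p y \<bullet> (x - y))"
    have c: "c > 0" unfolding c_def by (rule affine_factor_pos[OF x y])
    have "((\<lambda>x. 1 / \<alpha> * ln (1 + \<alpha> * (p y \<bullet> (x - y))) - (\<phi> x - \<phi> y)) has_derivative
        (\<lambda>v. p y \<bullet> v / c - p x \<bullet> v)) (at x)"
      by (rule derivative_eq_intros has_derivative_potential[OF x] refl
          c[unfolded c_def])+
         (use alpha_pos in \<open>auto simp: c_def fun_eq_iff field_simps\<close>)
    then have "((\<lambda>x. L_div \<alpha> \<phi> x y) has_derivative (\<lambda>v. p y \<bullet> v / c - p x \<bullet> v)) (at (x + 0 *\<^sub>R a))"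
      by (simp add: L_div_def[abs_def])
    from has_vector_derivative_along_line[OF this]
    have der: "(f has_real_derivative p y \<bullet> a / c - p x \<bullet> a) (at 0)"
      by (simp add: f_def[abs_def] has_real_derivative_iff_has_vector_derivative)
    have "\<forall>\<^sub>F t in nhds 0. x + t *\<^sub>R a \<in> \<Theta>"
    proof (rule topological_tendstoD[OF _ open_domain])
      show "((\<lambda>t. x + t *\<^sub>R a) \<longlongrightarrow> x) (nhds 0)"
        by (auto intro!: tendsto_eq_intros filterlim_ident)
    qed (rule x)
    \<comment> \<open>Openness of \<Theta> gives a two-sided interval on which \<open>f\<close> is
      defined through points of \<Theta>, so the minimum at 0 is interior and the derivative
      vanishes there.\<close>
    then obtain d where d: "d > 0" "\<And>t. dist t 0 < d \<Longrightarrow> x + t *\<^sub>R a \<in> \<Theta>"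
      unfolding eventually_nhds_metric by blast
    have "\<forall>t. \<bar>0 - t\<bar> < d \<longrightarrow> f 0 \<le> f t"
      using d(2) that by (auto simp: f_def intro!: min subspace_scale[OF A])
    from DERIV_local_min[OF der d(1) this] c show ?thesis
      unfolding c_def[symmetric] by (simp add: field_simps)
  qed
  then show ?thesis using mem_dual_complement_direction_iff[OF x y] by blast
qed

section \<open>The derivative of the dual map and the Eguchi metric\<close>

definition dual_map_deriv :: "real ^ 'd \<Rightarrow> real ^ 'd \<Rightarrow> real ^ 'd" where
  "dual_map_deriv x v = (1 / w x) *\<^sub>R H x v + (\<alpha> * (H x v \<bullet> x + p x \<bullet> v) / (w x)\<^sup>2) *\<^sub>R p x"

lemma has_derivative_dual_map:
  assumes x: "x \<in> \<Theta>"
  shows "(dual_map \<alpha> \<phi> has_derivative dual_map_deriv x) (at x)"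
proof -
  have w: "w x \<noteq> 0" using weight_pos[OF x] by simp
  show ?thesis
    unfolding dual_map_def[abs_def] dual_map_deriv_def[abs_def]
    by (rule derivative_eq_intros has_derivative_gradient[OF x] refl w)+
       (use w in \<open>simp add: fun_eq_iff power2_eq_square algebra_simps divide_inverse\<close>)
qed

text \<open>Infinitesimal counterpart of \<open>conormal_dual_map_diff\<close>. Paired with
  \<open>v\<close>, the right side is the quadratic form of \<open>hessian_negative\<close>.\<close>

lemma conormal_dual_map_deriv:
  assumes x: "x \<in> \<Theta>"
  shows "w x *\<^sub>R conormal x (dual_map_deriv x v) = H x v + (\<alpha> * (p x \<bullet> v)) *\<^sub>R p x"
proof -
  define h where "h = H x v"
  define c where "c = w x"
  have c: "c \<noteq> 0" using weight_pos[OF x] by (simp add: c_def)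
  have px: "\<alpha> * (p x \<bullet> x) = 1 - c" by (simp add: c_def)
  have b: "c *\<^sub>R dual_map_deriv x v = h + (\<alpha> * (h \<bullet> x + p x \<bullet> v) / c) *\<^sub>R p x"
    using c by (simp add: dual_map_deriv_def flip: h_def c_def)
      (simp add: scaleR_add_right power2_eq_square)
  \<comment> \<open>Pairing \<open>b\<close> with \<open>x\<close> produces
    \<open>\<alpha> * (p x \<bullet> x)\<close>, which \<open>px\<close> replaces by
    \<open>1 - c\<close>; the terms over \<open>c\<close> then cancel against those in
    \<open>b\<close>.\<close>
  have "c * (dual_map_deriv x v \<bullet> x) = h \<bullet> x + (h \<bullet> x + p x \<bullet> v) / c * (\<alpha> * (p x \<bullet> x))"
    using arg_cong[OF b, of "\<lambda>z. z \<bullet> x"] by (simp add: inner_add_left ac_simps)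
  also have "\<dots> = (h \<bullet> x + p x \<bullet> v) / c - p x \<bullet> v"
    unfolding px using c by (simp add: field_simps)
  finally have bx: "c * (dual_map_deriv x v \<bullet> x) = (h \<bullet> x + p x \<bullet> v) / c - p x \<bullet> v" .
  have "c *\<^sub>R conormal x (dual_map_deriv x v) =
      c *\<^sub>R dual_map_deriv x v - (\<alpha> * (c * (dual_map_deriv x v \<bullet> x))) *\<^sub>R p x"
    by (simp add: conormal_def scaleR_diff_right ac_simps)
  also have "\<dots> = h + (\<alpha> * (p x \<bullet> v)) *\<^sub>R p x"
    unfolding b bx by (simp add: right_diff_distrib scaleR_diff_left)
  finally show ?thesis by (simp add: c_def h_def)
qed

lemma linear_dual_map_deriv: "x \<in> \<Theta> \<Longrightarrow> linear (dual_map_deriv x)"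
  using has_derivative_dual_map has_derivative_linear by blast

lemma inj_dual_map_deriv:
  assumes x: "x \<in> \<Theta>"
  shows "inj (dual_map_deriv x)"
proof (subst linear_injective_0[OF linear_dual_map_deriv[OF x]], intro allI impI)
  fix v assume "dual_map_deriv x v = 0"
  then have "H x v + (\<alpha> * (p x \<bullet> v)) *\<^sub>R p x = 0"
    using conormal_dual_map_deriv[OF x, of v] linear_0[OF linear_conormal] by simp
  then have "v \<bullet> (H x v + (\<alpha> * (p x \<bullet> v)) *\<^sub>R p x) = 0" by simp
  then have "v \<bullet> H x v + \<alpha> * (p x \<bullet> v)\<^sup>2 = 0"
    by (simp add: inner_add_right power2_eq_square inner_commute)
  then show "v = 0" using hessian_negative[OF x, of v] by fastforce
qed

text \<open>The derivative in the second argument is computed for every \<open>x\<close> in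
  \<Theta>, where the logarithm is smooth, and then differentiated in \<open>x\<close> at
  \<open>z\<close>. In view of \<open>hessian_negative\<close> the resulting metric is positive
  definite.\<close>

lemma eguchi_metric_L_div:
  assumes x: "z \<in> \<Theta>"
  shows "eguchi_metric (L_div \<alpha> \<phi>) z $ i $ j = - (H z (axis j 1) $ i + \<alpha> * p z $ i * p z $ j)"
proof -
  let ?h = "H z (axis j 1)"
  have inner: "partial j (\<lambda>y. L_div \<alpha> \<phi> x y) z =
      (?h \<bullet> (x - z) - p z $ j) / (1 + \<alpha> * (p z \<bullet> (x - z))) + p z $ j" if "x \<in> \<Theta>" for x
  proof -
    define c where "c = 1 + \<alpha> * (p z \<bullet> (x - z))"
    have c: "c > 0" unfolding c_def by (rule affine_factor_pos[OF that assms])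
    have "((\<lambda>y. 1 / \<alpha> * ln (1 + \<alpha> * (p y \<bullet> (x - y))) - (\<phi> x - \<phi> y)) has_derivative
        (\<lambda>v. (H z v \<bullet> (x - z) - p z \<bullet> v) / c + p z \<bullet> v)) (at z)"
      by (rule derivative_eq_intros has_derivative_potential[OF assms]
          has_derivative_gradient[OF assms] refl c[unfolded c_def])+
         (use alpha_pos c in \<open>simp add: fun_eq_iff field_simps flip: c_def\<close>)
    then have "((\<lambda>y. L_div \<alpha> \<phi> x y) has_derivative
        (\<lambda>v. (H z v \<bullet> (x - z) - p z \<bullet> v) / c + p z \<bullet> v)) (at z)"
      unfolding L_div_def .
    from partial_eq[OF this] show ?thesis by (simp add: inner_axis c_def)
  qed
  have "((\<lambda>x. (?h \<bullet> (x - z) - p z $ j) / (1 + \<alpha> * (p z \<bullet> (x - z))) + p z $ j) has_derivative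
      (\<lambda>v. ?h \<bullet> v + \<alpha> * (p z \<bullet> v) * p z $ j)) (at z)"
    by (auto intro!: derivative_eq_intros simp: fun_eq_iff)
  then have "((\<lambda>x. partial j (\<lambda>y. L_div \<alpha> \<phi> x y) z) has_derivative
      (\<lambda>v. ?h \<bullet> v + \<alpha> * (p z \<bullet> v) * p z $ j)) (at z)"
    by (rule has_derivative_transform_within_open[OF _ open_domain assms]) (simp add: inner)
  from partial_eq[OF this] show ?thesis
    by (simp add: eguchi_metric_def inner_axis)
qed

text \<open>Since \<open>w\<close> is positive, \<open>v\<close> is orthogonal to \<open>A\<close>
  exactly when \<open>dual_map_deriv\<close> maps it into
  \<open>dual_complement_direction A\<close>. This is how the metric enters the description of dual
  complements.\<close>

lemma riemannian_inner_conormal: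
  assumes x: "theta P \<in> \<Theta>"
  shows "riemannian_inner \<alpha> \<phi> theta P u v =
    - (w (theta P) * (u \<bullet> conormal (theta P) (dual_map_deriv (theta P) v)))"
proof -
  define z where "z = theta P"
  have z: "z \<in> \<Theta>" using x by (simp add: z_def)
  have Hv: "H z v = (\<Sum>j\<in>UNIV. v $ j *\<^sub>R H z (axis j 1))"
    by (rule linear_axis_expansion[OF linear_H[OF z]])
  have "riemannian_inner \<alpha> \<phi> theta P u v =
     - (\<Sum>i\<in>UNIV. \<Sum>j\<in>UNIV. u $ i * (v $ j * H z (axis j 1) $ i)
        + \<alpha> * ((p z $ i * u $ i) * (p z $ j * v $ j)))"
    by (simp add: riemannian_inner_def eguchi_metric_L_div[OF z] algebra_simps sum_negf
        sum_subtractf sum.distrib flip: z_def)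
  also have "\<dots> = - (u \<bullet> H z v + \<alpha> * ((p z \<bullet> u) * (p z \<bullet> v)))"
    unfolding Hv inner_vec_def[of "p z"] sum_product
    by (simp add: inner_vec_def sum.distrib sum_distrib_left)
  also have "\<dots> = - (u \<bullet> (w z *\<^sub>R conormal z (dual_map_deriv z v)))"
    unfolding conormal_dual_map_deriv[OF z] by (simp add: inner_add_right inner_commute ac_simps)
  finally show ?thesis by (simp add: z_def)
qed

end

section \<open>The manifold: tangent spaces, dual complements and the foliation\<close>

locale charted_exp_concave = exp_concave_potential \<alpha> \<Theta> \<phi> H
  for \<alpha> :: real
    and \<Theta> :: "(real ^ 'd) set"
    and \<phi> :: "real ^ 'd \<Rightarrow> real"
    and H :: "real ^ 'd \<Rightarrow> real ^ 'd \<Rightarrow> real ^ 'd" +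
  fixes S :: "'s set"
    and theta :: "'s \<Rightarrow> real ^ 'd"
  assumes chart: "bij_betw theta S \<Theta>"
begin

abbreviation "\<eta> \<equiv> eta \<alpha> \<phi> theta"

lemma theta_mem: "P \<in> S \<Longrightarrow> theta P \<in> \<Theta>"
  using chart bij_betwE by blast

lemma theta_eq_iff: "P \<in> S \<Longrightarrow> Q \<in> S \<Longrightarrow> theta P = theta Q \<longleftrightarrow> P = Q"
  using chart by (auto simp: bij_betw_def inj_on_def)

abbreviation "point \<equiv> inv_into S theta"

lemma point_mem: "x \<in> \<Theta> \<Longrightarrow> point x \<in> S"
  and theta_point: "x \<in> \<Theta> \<Longrightarrow> theta (point x) = x"
  using chart by (auto simp: bij_betw_def inv_into_into f_inv_into_f)

lemma point_theta: "P \<in> S \<Longrightarrow> point (theta P) = P"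
  using chart by (auto simp: bij_betw_def)

text \<open>Velocities lie in \<open>A\<close> by \<open>derivative_mem_subspace\<close>.
  Conversely, a straight line in the primal chart realizes each \<open>u\<close> in
  \<open>A\<close>, staying in \<Theta> for small times.\<close>

lemma tangent_space_theta_affine:
  assumes "P0 \<in> S" "subspace A"
  shows "tangent_space theta {P \<in> S. theta P - theta P0 \<in> A} P0 = A"
proof (intro equalityI subsetI)
  fix u assume "u \<in> tangent_space theta {P \<in> S. theta P - theta P0 \<in> A} P0"
  then obtain c where c: "c 0 = P0" "\<forall>\<^sub>F t in nhds 0. theta (c t) - theta P0 \<in> A"
    "((\<lambda>t. theta (c t)) has_vector_derivative u) (at 0)"
    unfolding tangent_space_def by (auto simp: eventually_conj_iff)
  then show "u \<in> A" by (intro derivative_mem_subspace[OF assms(2) c(3)]) auto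
next
  fix u assume u: "u \<in> A"
  define x where "x t = theta P0 + t *\<^sub>R u" for t
  have x: "(x has_vector_derivative u) (at 0)"
    unfolding x_def[abs_def] by (auto intro!: derivative_eq_intros)
  have "\<forall>\<^sub>F t in nhds 0. x t \<in> \<Theta>"
  proof (rule topological_tendstoD[OF _ open_domain])
    show "(x \<longlongrightarrow> theta P0) (nhds 0)"
      unfolding x_def[abs_def] by (auto intro!: tendsto_eq_intros filterlim_ident)
  qed (rule theta_mem[OF assms(1)])
  then obtain U where U: "open U" "0 \<in> U" "\<And>t. t \<in> U \<Longrightarrow> x t \<in> \<Theta>"
    unfolding eventually_nhds by blast
  have "((\<lambda>t. theta (point (x t))) has_vector_derivative u) (at 0)"
    by (rule has_vector_derivative_transform_within_open[OF x U(1,2)])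
       (simp add: theta_point U(3))
  moreover have "\<forall>\<^sub>F t in nhds 0. point (x t) \<in> {P \<in> S. theta P - theta P0 \<in> A}"
    unfolding eventually_nhds
  proof (intro exI[of _ U] conjI ballI)
    fix t assume "t \<in> U"
    then have "point (x t) \<in> S" "theta (point (x t)) - theta P0 = t *\<^sub>R u"
      using point_mem theta_point U(3) by (auto simp: x_def)
    then show "point (x t) \<in> {P \<in> S. theta P - theta P0 \<in> A}"
      using subspace_scale[OF assms(2) u] by simp
  qed (use U in auto)
  moreover have "point (x 0) = P0" by (simp add: x_def point_theta assms(1))
  ultimately show "u \<in> tangent_space theta {P \<in> S. theta P - theta P0 \<in> A} P0"
    unfolding tangent_space_def by (intro CollectI exI[of _ "\<lambda>t. point (x t)"]) auto
qed

text \<open>The chain rule moves velocities to dual coordinates. Conversely, a straight line in dual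
  coordinates is pulled back by the inverse of the dual map, whose derivative is the inverse of
  \<open>dual_map_deriv\<close>.\<close>

lemma tangent_space_eta_affine:
  assumes P0: "P0 \<in> S" and B: "subspace B"
  shows "tangent_space theta {P \<in> S. \<eta> P - \<eta> P0 \<in> B} P0 =
    {v. dual_map_deriv (theta P0) v \<in> B}"
proof (intro equalityI subsetI)
  fix v assume "v \<in> tangent_space theta {P \<in> S. \<eta> P - \<eta> P0 \<in> B} P0"
  then obtain c where c: "c 0 = P0" "\<forall>\<^sub>F t in nhds 0. \<eta> (c t) - \<eta> P0 \<in> B"
    "((\<lambda>t. theta (c t)) has_vector_derivative v) (at 0)"
    unfolding tangent_space_def by (auto simp: eventually_conj_iff)
  have "(dual_map \<alpha> \<phi> has_derivative dual_map_deriv (theta P0)) (at (theta (c 0)))"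
    using has_derivative_dual_map[OF theta_mem[OF P0]] c(1) by simp
  from vector_derivative_diff_chain_within[OF c(3) has_derivative_at_withinI[OF this]]
  have "((\<lambda>t. \<eta> (c t)) has_vector_derivative dual_map_deriv (theta P0) v) (at 0)"
    by (simp add: o_def eta_def)
  then show "v \<in> {v. dual_map_deriv (theta P0) v \<in> B}"
    using derivative_mem_subspace[OF B] c by auto
next
  fix v assume "v \<in> {v. dual_map_deriv (theta P0) v \<in> B}"
  then have b: "dual_map_deriv (theta P0) v \<in> B" by simp
  define T where "T = dual_map \<alpha> \<phi>"
  define g where "g = inv_into \<Theta> T"
  define D where "D = dual_map_deriv (theta P0)"
  note x0 = theta_mem[OF P0]
  have contT: "continuous_on \<Theta> T"
    unfolding T_def using has_derivative_dual_map
    by (meson continuous_at_imp_continuous_on has_derivative_continuous)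
  \<comment> \<open>Invariance of domain keeps the line \<open>y\<close> below inside the range of
    \<open>T\<close> for small times.\<close>
  have openT: "open (T ` \<Theta>)"
    using invariance_of_domain[OF contT open_domain] inj_dual_map T_def by blast
  have gT: "g (T x) = x" if "x \<in> \<Theta>" for x
    unfolding g_def T_def using inj_dual_map that by simp
  have injD: "inj D"
    unfolding D_def by (rule inj_dual_map_deriv[OF x0])
  have surjD: "surj D"
    using linear_injective_imp_surjective[OF linear_dual_map_deriv[OF x0]] injD
    by (simp add: D_def)
  have g: "(g has_derivative inv D) (at (T (theta P0)))"
    using has_derivative_inverse_strong[OF open_domain x0 contT gT _ surj_iff[THEN iffD1, OF surjD]]
      has_derivative_dual_map[OF x0] by (simp add: T_def D_def)
  define y where "y t = T (theta P0) + t *\<^sub>R D v" for t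
  have y: "((\<lambda>t. g (y t)) has_vector_derivative v) (at 0)"
    using has_vector_derivative_along_line[of g "inv D" "T (theta P0)" 0 "D v"] g injD
    by (simp add: y_def[abs_def])
  have "\<forall>\<^sub>F t in nhds 0. y t \<in> T ` \<Theta>"
  proof (rule topological_tendstoD[OF _ openT])
    show "(y \<longlongrightarrow> T (theta P0)) (nhds 0)"
      unfolding y_def[abs_def] by (auto intro!: tendsto_eq_intros filterlim_ident)
  qed (use x0 in blast)
  then obtain U where U: "open U" "0 \<in> U" "\<And>t. t \<in> U \<Longrightarrow> y t \<in> T ` \<Theta>"
    unfolding eventually_nhds by blast
  have gy: "g (y t) \<in> \<Theta>" "T (g (y t)) = y t" if "t \<in> U" for t
    unfolding g_def using U(3)[OF that] by (auto intro: inv_into_into f_inv_into_f)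
  have "((\<lambda>t. theta (point (g (y t)))) has_vector_derivative v) (at 0)"
    by (rule has_vector_derivative_transform_within_open[OF y U(1,2)])
       (simp add: theta_point gy)
  moreover have "\<forall>\<^sub>F t in nhds 0. point (g (y t)) \<in> {P \<in> S. \<eta> P - \<eta> P0 \<in> B}"
    unfolding eventually_nhds
  proof (intro exI[of _ U] conjI ballI)
    fix t assume t: "t \<in> U"
    have "\<eta> (point (g (y t))) = y t"
      using gy[OF t] by (simp add: eta_def theta_point T_def)
    moreover have "\<eta> P0 = T (theta P0)" by (simp add: eta_def T_def)
    ultimately show "point (g (y t)) \<in> {P \<in> S. \<eta> P - \<eta> P0 \<in> B}"
      using subspace_scale[OF B b] gy(1)[OF t] by (simp add: y_def D_def point_mem)
  qed (use U in auto)
  moreover have "point (g (y 0)) = P0" by (simp add: y_def gT x0 point_theta P0)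
  ultimately show "v \<in> tangent_space theta {P \<in> S. \<eta> P - \<eta> P0 \<in> B} P0"
    unfolding tangent_space_def by (intro CollectI exI[of _ "\<lambda>t. point (g (y t))"]) auto
qed

text \<open>For a dual slice with direction \<open>B\<close>, orthogonality to \<open>A\<close>
  amounts to \<open>B\<close> being contained in \<open>B0\<close>; equal dimensions then force
  equality, so the definite description has exactly one solution.\<close>

lemma dual_complement_eq:
  assumes P0: "P0 \<in> S" and A: "subspace A" "dim A = k"
  shows "dual_complement S \<alpha> \<phi> theta k {P \<in> S. theta P - theta P0 \<in> A} P0 =
    {P \<in> S. \<eta> P - \<eta> P0 \<in> dual_complement_direction A (theta P0)}"
proof -
  define E where "E = {P \<in> S. theta P - theta P0 \<in> A}"
  define B0 where "B0 = dual_complement_direction A (theta P0)"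
  define x0 where "x0 = theta P0"
  have x0: "x0 \<in> \<Theta>" using theta_mem[OF P0] by (simp add: x0_def)
  have B0: "subspace B0" "dim B0 = CARD('d) - k"
    using subspace_dual_complement_direction dim_dual_complement_direction[OF x0 A(1)] A(2)
    by (auto simp: B0_def x0_def)
  have TE: "tangent_space theta E P0 = A"
    unfolding E_def by (rule tangent_space_theta_affine[OF P0 A(1)])
  have orth: "(\<forall>u\<in>A. riemannian_inner \<alpha> \<phi> theta P0 u v = 0) \<longleftrightarrow> dual_map_deriv x0 v \<in> B0" for v
    using riemannian_inner_conormal[of theta P0, OF theta_mem[OF P0]] weight_pos[OF x0]
    by (auto simp: B0_def dual_complement_direction_def x0_def)
  show ?thesis
    unfolding dual_complement_def E_def[symmetric] B0_def[symmetric]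
  proof (rule the_equality, intro conjI)
    let ?M = "{P \<in> S. \<eta> P - \<eta> P0 \<in> B0}"
    show "maximal_autoparallel S \<eta> (CARD('d) - k) ?M"
      unfolding maximal_autoparallel_def using P0 B0 by blast
    have "Q = P0" if "Q \<in> E" "Q \<in> ?M" for Q
    proof -
      have Q: "Q \<in> S" "theta Q - theta P0 \<in> A" "\<eta> Q - \<eta> P0 \<in> B0" using that E_def by auto
      \<comment> \<open>Uniqueness is used with \<open>theta Q\<close> as both \<open>y\<close> and
        \<open>q\<close>, so the condition at \<open>q\<close> concerns the zero vector.\<close>
      then have "theta P0 = theta Q"
        using theta_mem[OF Q(1)] theta_mem[OF P0]
        by (intro eq_if_common_dual_complement[OF _ _ _ Q(2) A(1), of "theta Q"])
           (auto simp: eta_def B0_def subspace_0[OF subspace_dual_complement_direction])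
      then show ?thesis using theta_eq_iff P0 Q(1) by simp
    qed
    moreover have "P0 \<in> E \<inter> ?M"
      using P0 subspace_0[OF A(1)] subspace_0[OF B0(1)] by (simp add: E_def)
    ultimately show "E \<inter> ?M = {P0}" by blast
    show "\<forall>u\<in>tangent_space theta E P0. \<forall>v\<in>tangent_space theta ?M P0.
        riemannian_inner \<alpha> \<phi> theta P0 u v = 0"
      unfolding TE tangent_space_eta_affine[OF P0 B0(1)] using orth by (auto simp: x0_def)
  next
    fix M
    assume M: "maximal_autoparallel S \<eta> (CARD('d) - k) M \<and> E \<inter> M = {P0} \<and>
      (\<forall>u\<in>tangent_space theta E P0. \<forall>v\<in>tangent_space theta M P0.
        riemannian_inner \<alpha> \<phi> theta P0 u v = 0)"
    then have "P0 \<in> M" by blast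
    with conjunct1[OF M] obtain B where B: "subspace B" "dim B = CARD('d) - k"
      and MB: "M = {P \<in> S. \<eta> P - \<eta> P0 \<in> B}"
      by (rule autoparallel_rebase)
    have "B \<subseteq> B0"
    proof
      fix b assume b: "b \<in> B"
      \<comment> \<open>Surjectivity makes every \<open>b\<close> in \<open>B\<close> the dual
        velocity of a tangent vector of \<open>M\<close>, to which the orthogonality hypothesis
        applies.\<close>
      have "surj (dual_map_deriv x0)"
        using linear_injective_imp_surjective[OF linear_dual_map_deriv inj_dual_map_deriv] x0
        by simp
      then obtain v where v: "b = dual_map_deriv x0 v" by (metis surjD)
      then have "v \<in> tangent_space theta M P0"
        unfolding MB tangent_space_eta_affine[OF P0 B(1)] using b by (simp add: x0_def)
      then have "\<forall>u\<in>A. riemannian_inner \<alpha> \<phi> theta P0 u v = 0"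
        using M unfolding TE by blast
      then show "b \<in> B0" unfolding orth v .
    qed
    then have "B = B0" using subspace_dim_equal[OF B(1) B0(1)] B(2) B0(2) by simp
    then show "M = {P \<in> S. \<eta> P - \<eta> P0 \<in> B0}" using MB by simp
  qed
qed

lemma dual_foliation:
  assumes E: "maximal_autoparallel S theta k E"
    and min: "\<And>P. P \<in> S \<Longrightarrow>
      \<exists>Q0\<in>E. \<forall>Q\<in>E. divergence \<alpha> \<phi> theta Q0 P \<le> divergence \<alpha> \<phi> theta Q P"
  shows "S = (\<Union>P0\<in>E. dual_complement S \<alpha> \<phi> theta k E P0) \<and>
    disjoint_family_on (dual_complement S \<alpha> \<phi> theta k E) E"
proof -
  obtain P1 where "P1 \<in> E"
    using E subspace_0 unfolding maximal_autoparallel_def by fastforce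
  with E obtain A where A: "subspace A" "dim A = k"
    and E_eq: "E = {P \<in> S. theta P - theta P1 \<in> A}"
    by (rule autoparallel_rebase)
  have ES: "P \<in> S" if "P \<in> E" for P using that E_eq by simp
  have rebase: "E = {P \<in> S. theta P - theta P0 \<in> A}" if "P0 \<in> E" for P0
    using affine_slice_rebase[OF A(1), of P0 S theta P1] that E_eq by simp
  have diff: "theta Q - theta P0 \<in> A" if "Q \<in> E" "P0 \<in> E" for Q P0
    using rebase[OF that(2)] that(1) by blast
  have dc: "dual_complement S \<alpha> \<phi> theta k E P0 =
      {P \<in> S. \<eta> P - \<eta> P0 \<in> dual_complement_direction A (theta P0)}" if "P0 \<in> E" for P0
    using dual_complement_eq[OF ES[OF that] A] rebase[OF that] by simp
  have cover: "\<exists>P0\<in>E. P \<in> dual_complement S \<alpha> \<phi> theta k E P0" if P: "P \<in> S" for P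
  proof -
    obtain P0 where P0: "P0 \<in> E"
      and le: "\<And>Q. Q \<in> E \<Longrightarrow> divergence \<alpha> \<phi> theta P0 P \<le> divergence \<alpha> \<phi> theta Q P"
      using min[OF P] by blast
    have "L_div \<alpha> \<phi> (theta P0) (theta P) \<le> L_div \<alpha> \<phi> q (theta P)"
      if "q \<in> \<Theta>" "q - theta P0 \<in> A" for q
    proof -
      \<comment> \<open>The chart is onto \<Theta>, so a minimum over \<open>E\<close> is a minimum
        over the whole slice of \<Theta>.\<close>
      have "point q \<in> E" using rebase[OF P0] that point_mem theta_point by auto
      from le[OF this] show ?thesis by (simp add: divergence_def theta_point that)
    qed
    from minimizer_imp_dual_complement[OF theta_mem[OF ES[OF P0]] theta_mem[OF P] A(1) this]
    show ?thesis using P P0 by (auto simp: dc eta_def)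
  qed
  have "P0 = Q0" if "P0 \<in> E" "Q0 \<in> E" "P \<in> dual_complement S \<alpha> \<phi> theta k E P0"
    "P \<in> dual_complement S \<alpha> \<phi> theta k E Q0" for P P0 Q0
  proof -
    have "P \<in> S" using that dc by blast
    then have "theta P0 = theta Q0"
      using that theta_mem ES diff
      by (intro eq_if_common_dual_complement[of _ "theta P" _ A]) (auto simp: dc eta_def A)
    then show ?thesis using theta_eq_iff ES that by blast
  qed
  then have "disjoint_family_on (dual_complement S \<alpha> \<phi> theta k E) E"
    unfolding disjoint_family_on_def by blast
  then show ?thesis using cover dc by blast
qed

end

theorem corollary1:
  fixes \<alpha> :: real
    and \<Theta> :: "(real ^ 'd) set"
    and \<phi> :: "real ^ 'd \<Rightarrow> real"
    and S :: "'s set"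
    and theta :: "'s \<Rightarrow> real ^ 'd"
    and k :: nat
    and E :: "'s set"
  assumes "\<alpha> > 0"
    and "\<Theta> \<noteq> {}" and "open \<Theta>" and "convex \<Theta>"
    and "smooth_on \<phi> \<Theta>"
    and "concave_on \<Theta> (\<lambda>x. exp (\<alpha> * \<phi> x))"
    and "\<And>x v. x \<in> \<Theta> \<Longrightarrow> v \<noteq> 0 \<Longrightarrow> v \<bullet> (hessian (\<lambda>y. exp (\<alpha> * \<phi> y)) x *v v) < 0"
    and "\<And>x. x \<in> \<Theta> \<Longrightarrow> 1 - \<alpha> * (gradient \<phi> x \<bullet> x) > 0"
    and "bij_betw theta S \<Theta>"
    and "1 \<le> k" and "k < CARD('d)"
    and "maximal_autoparallel S theta k E"
    and "\<And>P. P \<in> S \<Longrightarrow>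
           \<exists>Q0\<in>E. \<forall>Q\<in>E. divergence \<alpha> \<phi> theta Q0 P \<le> divergence \<alpha> \<phi> theta Q P"
  shows "S = (\<Union>P0\<in>E. dual_complement S \<alpha> \<phi> theta k E P0) \<and>
         disjoint_family_on (dual_complement S \<alpha> \<phi> theta k E) E"
proof -
  note open_dom = assms(3) and negative = assms(7)
  have phi: "(\<phi> has_derivative (\<lambda>v. gradient \<phi> x \<bullet> v)) (at x)" if "x \<in> \<Theta>" for x
  proof -
    have "Ck_on 1 \<phi> \<Theta>" using assms(5) unfolding smooth_on_def by blast
    then have "(\<phi> has_derivative frechet_derivative \<phi> (at x)) (at x)"
      using that by (simp flip: frechet_derivative_works)
    then show ?thesis using gradient_inner by metis
  qed
  define H where "H x = frechet_derivative (gradient \<phi>) (at x)" for x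
  have H: "(gradient \<phi> has_derivative H x) (at x)" if "x \<in> \<Theta>" for x
    using gradient_differentiable_of_Ck[OF _ open_dom that] assms(5)
    unfolding H_def smooth_on_def by (simp flip: frechet_derivative_works)
  interpret charted_exp_concave \<alpha> \<Theta> \<phi> H S theta
  proof
    show "v \<bullet> H x v + \<alpha> * (gradient \<phi> x \<bullet> v)\<^sup>2 < 0" if "x \<in> \<Theta>" "v \<noteq> 0" for x v
    proof -
      have "v \<bullet> (hessian (\<lambda>y. exp (\<alpha> * \<phi> y)) x *v v) =
          \<alpha> * exp (\<alpha> * \<phi> x) * (v \<bullet> H x v + \<alpha> * (gradient \<phi> x \<bullet> v)\<^sup>2)"
        by (rule hessian_exp_quadratic_form[OF open_dom that(1) phi H[OF that(1)]])
      then show ?thesis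
        using assms(1) negative[OF that] by (simp add: mult_less_0_iff)
    qed
    show "1 - \<alpha> * (gradient \<phi> x \<bullet> x) > 0" if "x \<in> \<Theta>" for x
      by (rule assms(8)[OF that])
    show "bij_betw theta S \<Theta>" by (rule assms(9))
  qed (use assms(1,3,4) phi H in blast)+
  show ?thesis using dual_foliation assms(12,13) by blast
qed

end
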